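(* Let $c>0$, $\omega\in\mathbb R$ with $\omega\ne0$, and consider the network $$\dot x_\ell=\mu x_\ell-\omega y_\ell-x_\ell(x_\ell^2+y_\ell^2)+c\sum_{k=1}^N a_{\ell k}(x_k-x_\ell),\qquad \dot y_\ell=\omega x_\ell+\mu y_\ell-y_\ell(x_\ell^2+y_\ell^2)+c\sum_{k=1}^N a_{\ell k}(y_k-y_\ell),$$ $\ell=1,\dots,N$, with bifurcation parameter $\mu\in\mathbb R$ and $s$-nearest-neighbor ring coupling $[a_{\ell k}]$ in the non-all-to-all cases: $N$ is even with $1\le s\le\frac N2-1$, or $N$ is odd with $1\le s\le\frac{N-1}{2}-1$. Let $M_1,\dots,M_N$ be the $2\times2$ Fourier blocks of the Jacobian matrix at the origin, and for $j=2,3,\dots,N$ put $$\mu_j:=2c\left(s-\frac{\sin\left[\frac{s(j-1)\pi}{N}\right]\cos\left[\frac{(s+1)(j-1)\pi}{N}\right]}{\sin\left[\frac{(j-1)\pi}{N}\right]}\right).$$ Besides the Hopf bifurcation at $\mu=0$ associated with the block $M_1$, there are additional critical parameter values $\mu=\mu_j$, $j=2,3,\dots,N$, at which the Jacobian matrix has purely imaginary eigenvalues $\pm\mathrm i\omega$ arising from the corresponding blocks $M_j$. The symmetry relation $\mu_j=\mu_{N+2-j}$ implies the following simultaneous contributions. (i) If $N$ is even and $j\in\{2,\dots,N\}$, $j\ne j^\ast:=1+\frac N2$, then $j$ and $N+2-j$ form a distinct pair. Consequently, at $\mu=\mu_j$ the blocks $M_j$ and $M_{N+2-j}$ simultaneously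 contribute two pairs of purely imaginary eigenvalues $\pm\mathrm i\omega$. (ii) If $N$ is even and $j=j^\ast$, then $j^\ast$ is unpaired in the sense that $j^\ast=N+2-j^\ast$. In this case the block $M_{j^\ast}$ contributes a single pair of purely imaginary eigenvalues $\pm\mathrm i\omega$ at $\mu=\mu_{j^\ast}$. If $\mu_{j^\ast}\ne\mu_k$ for all $k\in\{2,\dots,N\}$ with $k\ne j^\ast$, then this pair is the only purely imaginary eigenvalue pair of the Jacobian matrix present at $\mu=\mu_{j^\ast}$. (iii) If $N$ is odd, then for every $j=2,3,\dots,N$ the indices $j$ and $N+2-j$ form a pair (of distinct indices). Hence, at $\mu=\mu_j$, the blocks $M_j$ and $M_{N+2-j}$ simultaneously contribute two pairs of purely imaginary eigenvalues $\pm\mathrm i\omega$.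
   Context: $s$-nearest-neighbor ring coupling: $a_{\ell k}=1$ if $1\le|\ell-k|_N\le s$ and $a_{\ell k}=0$ otherwise, where $|\ell-k|_N:=\min\{|\ell-k|,N-|\ell-k|\}$. Jacobian and Fourier blocks: with variables ordered $(x_1,y_1,\dots,x_N,y_N)$, the $2N\times2N$ Jacobian matrix at the origin is block-circulant with first block row $(A_1,A_2,\dots,A_N)$ (each subsequent block row is shifted cyclically one place to the right), where the $A_k$ are $2\times2$ matrices: $A_1=\begin{bmatrix}\mu-2sc&-\omega\\ \omega&\mu-2sc\end{bmatrix}$ and $A_k=c\,a_{1k}I_2$ for $k\ge2$. Put $w=e^{-2\pi\mathrm i/N}$, $F_2=\frac1{\sqrt2}\begin{bmatrix}1&1\\1&-1\end{bmatrix}$, $B_{k-1}=F_2^*A_kF_2$, and $$M_j=\sum_{k=1}^N w^{(j-1)(k-1)}B_{k-1},\qquad j=1,\dots,N.$$ The Jacobian is unitarily similar to $\operatorname{diag}(M_1,\dots,M_N)$. The block $M_1$ corresponds to the synchronous mode (the dynamics on the invariant manifold $\{x_1=\cdots=x_N,\ y_1=\cdots=y_N\}$, given by $\dot x=\mu x-\omega y-x(x^2+y^2)$, $\dot y=\omega x+\mu y-y(x^2+y^2)$, which has a Hopf bifurcation at the origin at $\mu=0$); $M_2,\dots,M_N$ correspond to non-synchronous modes. A parameter value is critical when the Jacobian at the origin has an eigenvalue with zero real part. A block "contributes a pair $\pm\mathrm i\omega$" at a value of $\mu$ if its two eigenvalues at that $\mu$ are $\pm\mathrm i\omega$; pairs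 are counted with multiplicity over the blocks. *)

theory Defs
  imports
    "HOL-Analysis.Derivative"
    "HOL-Analysis.Complex_Transcendental"
    "Jordan_Normal_Form.Spectral_Radius"
begin

section \<open>Ring coupling and the network\<close>

definition ring_dist :: "nat \<Rightarrow> nat \<Rightarrow> nat \<Rightarrow> int" where
  "ring_dist N l k = min \<bar>int l - int k\<bar> (int N - \<bar>int l - int k\<bar>)"

definition ring_coupling :: "nat \<Rightarrow> nat \<Rightarrow> nat \<Rightarrow> nat \<Rightarrow> real" where
  "ring_coupling N s l k = (if 1 \<le> ring_dist N l k \<and> ring_dist N l k \<le> int s then 1 else 0)"

definition non_all_to_all :: "nat \<Rightarrow> nat \<Rightarrow> bool" where
  "non_all_to_all N s \<longleftrightarrow>
     (even N \<and> 1 \<le> s \<and> real s \<le> real N / 2 - 1) \<or>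
     (odd N \<and> 1 \<le> s \<and> real s \<le> (real N - 1) / 2 - 1)"

text \<open>
  A point of real \<open>n\<close>-space is a function on the indices \<open>0, \<dots>, n - 1\<close>; values at other
  indices are irrelevant. A network state lists \<open>x\<^sub>1, y\<^sub>1, \<dots>, x\<^sub>N, y\<^sub>N\<close> in this order,
  with cells numbered from 1.
\<close>

definition x_of :: "(nat \<Rightarrow> real) \<Rightarrow> nat \<Rightarrow> real" where
  "x_of z l = z (2 * (l - 1))"

definition y_of :: "(nat \<Rightarrow> real) \<Rightarrow> nat \<Rightarrow> real" where
  "y_of z l = z (2 * (l - 1) + 1)"

definition x_dot :: "nat \<Rightarrow> nat \<Rightarrow> real \<Rightarrow> real \<Rightarrow> real \<Rightarrow> (nat \<Rightarrow> real) \<Rightarrow> nat \<Rightarrow> real" where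
  "x_dot N s c \<omega> \<mu> z l =
     \<mu> * x_of z l - \<omega> * y_of z l - x_of z l * ((x_of z l)\<^sup>2 + (y_of z l)\<^sup>2)
     + c * (\<Sum>k=1..N. ring_coupling N s l k * (x_of z k - x_of z l))"

definition y_dot :: "nat \<Rightarrow> nat \<Rightarrow> real \<Rightarrow> real \<Rightarrow> real \<Rightarrow> (nat \<Rightarrow> real) \<Rightarrow> nat \<Rightarrow> real" where
  "y_dot N s c \<omega> \<mu> z l =
     \<omega> * x_of z l + \<mu> * y_of z l - y_of z l * ((x_of z l)\<^sup>2 + (y_of z l)\<^sup>2)
     + c * (\<Sum>k=1..N. ring_coupling N s l k * (y_of z k - y_of z l))"

definition network_field ::
  "nat \<Rightarrow> nat \<Rightarrow> real \<Rightarrow> real \<Rightarrow> real \<Rightarrow> (nat \<Rightarrow> real) \<Rightarrow> nat \<Rightarrow> real" where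
  "network_field N s c \<omega> \<mu> z i =
     (if even i then x_dot N s c \<omega> \<mu> z (i div 2 + 1) else y_dot N s c \<omega> \<mu> z (i div 2 + 1))"

text \<open>The dynamics on the synchronous manifold, with \<open>x = u 0\<close> and \<open>y = u 1\<close>.\<close>

definition sync_field :: "real \<Rightarrow> real \<Rightarrow> (nat \<Rightarrow> real) \<Rightarrow> nat \<Rightarrow> real" where
  "sync_field \<omega> \<mu> u i =
     (if i = 0 then \<mu> * u 0 - \<omega> * u 1 - u 0 * ((u 0)\<^sup>2 + (u 1)\<^sup>2)
      else \<omega> * u 0 + \<mu> * u 1 - u 1 * ((u 0)\<^sup>2 + (u 1)\<^sup>2))"

section \<open>Jacobian matrices\<close>

text \<open>The matrix of partial derivatives, regarded as a complex matrix in order to have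
  its complex spectrum available.\<close>

definition jacobian :: "nat \<Rightarrow> ((nat \<Rightarrow> real) \<Rightarrow> nat \<Rightarrow> real) \<Rightarrow> (nat \<Rightarrow> real) \<Rightarrow> complex mat" where
  "jacobian n f z = mat n n (\<lambda>(i, j). complex_of_real (deriv (\<lambda>t. f (z(j := t)) i) (z j)))"

definition network_jacobian :: "nat \<Rightarrow> nat \<Rightarrow> real \<Rightarrow> real \<Rightarrow> real \<Rightarrow> complex mat" where
  "network_jacobian N s c \<omega> \<mu> = jacobian (2 * N) (network_field N s c \<omega> \<mu>) (\<lambda>_. 0)"

definition alg_mult :: "complex mat \<Rightarrow> complex \<Rightarrow> nat" where
  "alg_mult J z = Polynomial.order z (char_poly J)"

definition critical_value :: "nat \<Rightarrow> nat \<Rightarrow> real \<Rightarrow> real \<Rightarrow> real \<Rightarrow> bool" where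
  "critical_value N s c \<omega> \<mu> \<longleftrightarrow> (\<exists>z \<in> spectrum (network_jacobian N s c \<omega> \<mu>). Re z = 0)"

definition unitarily_similar :: "complex mat \<Rightarrow> complex mat \<Rightarrow> bool" where
  "unitarily_similar A B \<longleftrightarrow> (\<exists>U. similar_mat_wit A B U (mat_adjoint U))"

section \<open>Fourier blocks\<close>

definition A_block :: "nat \<Rightarrow> nat \<Rightarrow> real \<Rightarrow> real \<Rightarrow> real \<Rightarrow> nat \<Rightarrow> complex mat" where
  "A_block N s c \<omega> \<mu> k =
     (if k = 1 then
        mat_of_rows_list 2
          [[complex_of_real (\<mu> - 2 * real s * c), complex_of_real (- \<omega>)],
           [complex_of_real \<omega>, complex_of_real (\<mu> - 2 * real s * c)]]
      else complex_of_real (c * ring_coupling N s 1 k) \<cdot>\<^sub>m 1\<^sub>m 2)"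

definition F2 :: "complex mat" where
  "F2 = complex_of_real (1 / sqrt 2) \<cdot>\<^sub>m mat_of_rows_list 2 [[1, 1], [1, -1]]"

text \<open>As in the literature the index of \<open>B\<close> is shifted by one: \<open>B\<^sub>m\<close> comes from \<open>A\<^sub>m\<^sub>+\<^sub>1\<close>.\<close>

definition B_block :: "nat \<Rightarrow> nat \<Rightarrow> real \<Rightarrow> real \<Rightarrow> real \<Rightarrow> nat \<Rightarrow> complex mat" where
  "B_block N s c \<omega> \<mu> m = mat_adjoint F2 * A_block N s c \<omega> \<mu> (m + 1) * F2"

definition root_w :: "nat \<Rightarrow> complex" where
  "root_w N = exp (- (2 * complex_of_real pi * \<i> / of_nat N))"

text \<open>Matrices of no fixed size form no additive monoid, hence the entrywise sum.\<close>

definition fourier_block :: "nat \<Rightarrow> nat \<Rightarrow> real \<Rightarrow> real \<Rightarrow> real \<Rightarrow> nat \<Rightarrow> complex mat" where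
  "fourier_block N s c \<omega> \<mu> j =
     mat 2 2 (\<lambda>(p, q). \<Sum>k=1..N. root_w N ^ ((j - 1) * (k - 1)) * B_block N s c \<omega> \<mu> (k - 1) $$ (p, q))"

definition critical_mu :: "nat \<Rightarrow> nat \<Rightarrow> real \<Rightarrow> nat \<Rightarrow> real" where
  "critical_mu N s c j =
     2 * c * (real s - sin (real s * (real j - 1) * pi / real N)
                       * cos ((real s + 1) * (real j - 1) * pi / real N)
                       / sin ((real j - 1) * pi / real N))"

definition imag_pair :: "real \<Rightarrow> complex set" where
  "imag_pair \<omega> = {\<i> * complex_of_real \<omega>, - (\<i> * complex_of_real \<omega>)}"

text \<open>For \<open>\<omega> \<noteq> 0\<close> the pair consists of two distinct numbers, so the equation below says that
  they are the two eigenvalues of the \<open>2 \<times> 2\<close> block.\<close>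

definition contributes_pair :: "nat \<Rightarrow> nat \<Rightarrow> real \<Rightarrow> real \<Rightarrow> real \<Rightarrow> nat \<Rightarrow> bool" where
  "contributes_pair N s c \<omega> \<mu> j \<longleftrightarrow> spectrum (fourier_block N s c \<omega> \<mu> j) = imag_pair \<omega>"

text \<open>The number of pairs contributed by the blocks with index in \<open>S\<close>, counted with
  multiplicity over the blocks.\<close>

definition pairs_contributed :: "nat \<Rightarrow> nat \<Rightarrow> real \<Rightarrow> real \<Rightarrow> real \<Rightarrow> nat set \<Rightarrow> nat" where
  "pairs_contributed N s c \<omega> \<mu> S = card {j \<in> S. contributes_pair N s c \<omega> \<mu> j}"

section \<open>Hopf bifurcation\<close>

definition periodic_orbit ::
  "nat \<Rightarrow> ((nat \<Rightarrow> real) \<Rightarrow> nat \<Rightarrow> real) \<Rightarrow> real \<Rightarrow> (real \<Rightarrow> nat \<Rightarrow> real) \<Rightarrow> bool" where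
  "periodic_orbit n f T z \<longleftrightarrow>
     0 < T \<and>
     (\<forall>t. \<forall>i<n. ((\<lambda>\<tau>. z \<tau> i) has_real_derivative f (z t) i) (at t)) \<and>
     (\<forall>t. \<forall>i<n. z (t + T) i = z t i) \<and>
     (\<exists>t t'. \<exists>i<n. z t i \<noteq> z t' i)"

text \<open>
  The family \<open>\<mu> \<mapsto> f \<mu>\<close> of vector fields on real \<open>n\<close>-space undergoes a Hopf bifurcation at the
  equilibrium \<open>p\<close> at \<open>\<mu> = \<mu>0\<close>: a simple eigenvalue \<open>ev \<mu>\<close> of the linearization crosses the
  imaginary axis with nonzero speed at a nonzero imaginary number, no further eigenvalues except
  its conjugate lie on the axis at \<open>\<mu>0\<close>, and a family of nonconstant periodic orbits, with
  parameter values \<open>m \<epsilon>\<close> and periods \<open>T \<epsilon>\<close>, emanates from the equilibrium.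
\<close>

definition hopf_bifurcation ::
  "nat \<Rightarrow> (real \<Rightarrow> (nat \<Rightarrow> real) \<Rightarrow> nat \<Rightarrow> real) \<Rightarrow> (nat \<Rightarrow> real) \<Rightarrow> real \<Rightarrow> bool" where
  "hopf_bifurcation n f p \<mu>0 \<longleftrightarrow>
     (\<forall>\<^sub>F \<mu> in nhds \<mu>0. \<forall>i<n. f \<mu> p i = 0) \<and>
     (\<exists>ev :: real \<Rightarrow> complex.
        (\<forall>\<^sub>F \<mu> in nhds \<mu>0. ev \<mu> \<in> spectrum (jacobian n (f \<mu>) p)) \<and>
        isCont ev \<mu>0 \<and>
        Re (ev \<mu>0) = 0 \<and> Im (ev \<mu>0) \<noteq> 0 \<and>
        (\<exists>d. d \<noteq> 0 \<and> ((\<lambda>\<mu>. Re (ev \<mu>)) has_real_derivative d) (at \<mu>0)) \<and>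
        alg_mult (jacobian n (f \<mu>0) p) (ev \<mu>0) = 1 \<and>
        {\<nu> \<in> spectrum (jacobian n (f \<mu>0) p). Re \<nu> = 0} = {ev \<mu>0, cnj (ev \<mu>0)} \<and>
        (\<exists>(m :: real \<Rightarrow> real) (T :: real \<Rightarrow> real) (z :: real \<Rightarrow> real \<Rightarrow> nat \<Rightarrow> real).
           (\<forall>\<^sub>F \<epsilon> in at_right 0. periodic_orbit n (f (m \<epsilon>)) (T \<epsilon>) (z \<epsilon>)) \<and>
           (m \<longlongrightarrow> \<mu>0) (at_right 0) \<and>
           (T \<longlongrightarrow> 2 * pi / \<bar>Im (ev \<mu>0)\<bar>) (at_right 0) \<and>
           (\<forall>\<delta>>0. \<forall>\<^sub>F \<epsilon> in at_right 0. \<forall>t. \<forall>i<n. \<bar>z \<epsilon> t i - p i\<bar> < \<delta>)))"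

end

theory Submission
  imports Defs
begin

text \<open>
  Each \<open>2 \<times> 2\<close> matrix that occurs, whether a block \<open>A\<^sub>k\<close>, a Fourier block, or the linearized
  synchronous dynamics, is a scaled rotation with rows \<open>(a, - b)\<close> and \<open>(b, a)\<close>, whose eigenvalues
  \<open>a \<plusminus> \<i> b\<close> are visible. Conjugation by the reflection \<open>F\<^sub>2\<close> reverses the rotation, so all Fourier
  blocks have the form \<open>a = \<mu> - \<nu>\<^sub>j\<close>, \<open>b = - \<omega>\<close>, and only the real number \<open>\<nu>\<^sub>j\<close> depends on the
  block.

  That number is \<open>c\<close> times the eigenvalue of the graph Laplacian of the ring on the Fourier mode
  \<open>k \<mapsto> w\<^sup>(\<^sup>j\<^sup>-\<^sup>1\<^sup>)\<^sup>(\<^sup>k\<^sup>-\<^sup>1\<^sup>)\<close>: pairing the neighbours at distance \<open>m\<close> on both sides gives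
  \<open>\<nu>\<^sub>j = 2 c \<Sum>\<^sub>m\<^sub>\<le>\<^sub>s (1 - cos (2 \<pi> (j - 1) m / N))\<close> (\<open>fourier_mode_eigenvector\<close>). Summing the
  cosines in closed form identifies it with \<open>\<mu>\<^sub>j\<close> (\<open>critical_mu_eq_coupling_shift\<close>). The
  cosine form shows at once that \<open>\<nu>\<^sub>1 = 0\<close>, that \<open>\<nu>\<^sub>j > 0\<close> for \<open>j \<ge> 2\<close>, and that \<open>j\<close> and
  \<open>N + 2 - j\<close> give the same value.

  Hence a block contributes the pair \<open>\<plusminus> \<i> \<omega>\<close> at \<open>\<mu>\<close> exactly if \<open>\<nu>\<^sub>j = \<mu>\<close>
  (\<open>contributes_pair_iff\<close>), and all claims on simultaneous contributions are statements about
  the fibres of \<open>j \<mapsto> \<nu>\<^sub>j\<close>. The discrete Fourier transform, tensored with \<open>F\<^sub>2\<close>, is a unitary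
  matrix that carries the Jacobian to the block diagonal matrix of the Fourier blocks
  (\<open>network_jacobian_unitarily_similar\<close>). So the characteristic polynomial of the Jacobian is the
  product of those of the blocks, and the multiplicity of \<open>\<plusminus> \<i> \<omega>\<close> is again the size of a fibre
  (\<open>alg_mult_network_jacobian\<close>).

  The Hopf bifurcation of the synchronous dynamics needs no general theorem, because the field is
  a normal form: the circle of radius \<open>r\<close> is a periodic orbit for \<open>\<mu> = r\<^sup>2\<close>, traversed with angular
  velocity \<open>\<omega>\<close> (\<open>periodic_orbit_sync_field\<close>).
\<close>

section \<open>Scaled rotations and block diagonal matrices\<close>

text \<open>
  For real \<open>a\<close> and \<open>b\<close> this is multiplication by \<open>a + \<i> b\<close> on the plane.
\<close>
definition scaled_rotation :: "complex \<Rightarrow> complex \<Rightarrow> complex mat" where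
  "scaled_rotation a b = mat 2 2 (\<lambda>(p, q). if p = q then a else if p = 0 then - b else b)"

lemma less_2_nat: "p < 2 \<longleftrightarrow> p = 0 \<or> p = (1::nat)"
  by auto

lemma scaled_rotation_carrier [simp]: "scaled_rotation a b \<in> carrier_mat 2 2"
  by (simp add: scaled_rotation_def)

lemma scaled_rotation_index [simp]:
  "p < 2 \<Longrightarrow> q < 2 \<Longrightarrow>
     scaled_rotation a b $$ (p, q) = (if p = q then a else if p = 0 then - b else b)"
  by (simp add: scaled_rotation_def)

lemma scaled_rotation_dim [simp]:
  "dim_row (scaled_rotation a b) = 2" "dim_col (scaled_rotation a b) = 2"
  by (simp_all add: scaled_rotation_def)

lemma det_mat_2:
  assumes "(A :: 'a :: comm_ring_1 mat) \<in> carrier_mat 2 2"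
  shows "det A = A $$ (0, 0) * A $$ (1, 1) - A $$ (0, 1) * A $$ (1, 0)"
proof -
  have "det A = (\<Sum>j<2. A $$ (0, j) * cofactor A 0 j)"
    using assms by (intro laplace_expansion_row) auto
  then show ?thesis
    using assms by (simp add: numeral_2_eq_2 cofactor_def det_single mat_delete_def lessThan_Suc)
qed

lemma char_poly_scaled_rotation:
  "char_poly (scaled_rotation a b) = [:- (a + \<i> * b), 1:] * [:- (a - \<i> * b), 1:]"
proof -
  have "char_poly (scaled_rotation a b) = [:- a, 1:] * [:- a, 1:] + [:b * b:]"
    unfolding char_poly_def det_mat_2[OF char_poly_matrix_closed[OF scaled_rotation_carrier]]
    by (simp add: char_poly_matrix_def)
  then show ?thesis by (simp add: algebra_simps)
qed

lemma spectrum_scaled_rotation: "spectrum (scaled_rotation a b) = {a + \<i> * b, a - \<i> * b}"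
proof -
  have "poly (char_poly (scaled_rotation a b)) x = (x - (a + \<i> * b)) * (x - (a - \<i> * b))" for x
    by (simp add: char_poly_scaled_rotation algebra_simps)
  then show ?thesis
    by (auto simp: spectrum_root_char_poly[OF scaled_rotation_carrier])
qed

lemma diag_block_mat_2_index:
  assumes "\<And>A. A \<in> set As \<Longrightarrow> A \<in> carrier_mat 2 2" "i < 2 * length As" "j < 2 * length As"
  shows "diag_block_mat As $$ (i, j) =
    (if i div 2 = j div 2 then As ! (i div 2) $$ (i mod 2, j mod 2) else 0)"
  using assms
proof (induction As arbitrary: i j)
  case Nil
  then show ?case by simp
next
  case (Cons A As)
  have dims: "dim_row A = 2" "dim_col A = 2"
    using Cons.prems(1)[of A] by auto
  have "map dim_row As = map (\<lambda>_. 2) As" "map dim_col As = map (\<lambda>_. 2) As"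
    using Cons.prems(1) by auto
  then have dims': "dim_row (diag_block_mat As) = 2 * length As"
      "dim_col (diag_block_mat As) = 2 * length As"
    unfolding dim_diag_block_mat by (simp_all only: sum_list_triv of_nat_id mult.commute)
  show ?case
  proof (cases "i < 2")
    case True
    then show ?thesis using Cons.prems dims dims'
      by (cases "j < 2") (auto simp: Let_def)
  next
    case False
    then obtain i' where i': "i = i' + 2" by (metis le_add_diff_inverse2 not_less)
    show ?thesis
    proof (cases "j < 2")
      case True
      then show ?thesis using Cons.prems dims dims' i' by (auto simp: Let_def)
    next
      case False
      then obtain j' where j': "j = j' + 2" by (metis le_add_diff_inverse2 not_less)
      have "diag_block_mat As $$ (i', j') =
          (if i' div 2 = j' div 2 then As ! (i' div 2) $$ (i' mod 2, j' mod 2) else 0)"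
        using Cons.prems i' j' by (intro Cons.IH) auto
      then show ?thesis using Cons.prems dims dims' i' j' by (auto simp: Let_def)
    qed
  qed
qed

lemma diag_block_mat_2_carrier:
  assumes "\<And>A. A \<in> set As \<Longrightarrow> A \<in> carrier_mat 2 2"
  shows "diag_block_mat As \<in> carrier_mat (2 * length As) (2 * length As)"
proof -
  have "map dim_row As = map (\<lambda>_. 2) As" "map dim_col As = map (\<lambda>_. 2) As"
    using assms by auto
  then show ?thesis
    by (intro carrier_matI; unfold dim_diag_block_mat; simp only: sum_list_triv of_nat_id mult.commute)
qed

text \<open>
  Induction over the list. The two-block case in the library asks both characteristic
  polynomials to split into linear factors, which over the complex numbers they do.
\<close>
lemma char_poly_diag_block_mat:
  fixes As :: "complex mat list"
  assumes "\<And>A. A \<in> set As \<Longrightarrow> square_mat A"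
  shows "char_poly (diag_block_mat As) = prod_list (map char_poly As)"
  using assms
proof (induction As)
  case Nil
  have "char_poly_matrix (0\<^sub>m 0 0 :: complex mat) \<in> carrier_mat 0 0"
    by (rule char_poly_matrix_closed) auto
  then show ?case by (simp add: char_poly_def)
next
  case (Cons A As)
  let ?D = "diag_block_mat As"
  have A: "A \<in> carrier_mat (dim_row A) (dim_row A)"
    using Cons.prems by (intro carrier_matI) auto
  have D: "?D \<in> carrier_mat (dim_row ?D) (dim_row ?D)"
    using diag_block_mat_square[of As] Cons.prems by (intro carrier_matI) auto
  have "char_poly (diag_block_mat (A # As)) = char_poly A * char_poly ?D"
  proof (rule char_poly_0_block[OF _ _ _ A zero_carrier_mat D])
    show "diag_block_mat (A # As) = four_block_mat A (0\<^sub>m (dim_row A) (dim_row ?D))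
        (0\<^sub>m (dim_row ?D) (dim_row A)) ?D"
      using carrier_matD(2)[OF A] carrier_matD(2)[OF D] by (simp only: diag_block_mat.simps Let_def)
    show "\<exists>es. char_poly A = (\<Prod>a\<leftarrow>es. [:- a, 1:])"
      using char_poly_factorized[OF A] by blast
    show "\<exists>es. char_poly ?D = (\<Prod>a\<leftarrow>es. [:- a, 1:])"
      using char_poly_factorized[OF D] by blast
  qed
  then show ?case using Cons by simp
qed

section \<open>The ring and its Fourier modes\<close>

lemma non_all_to_all_bounds:
  assumes "non_all_to_all N s"
  shows "1 \<le> s" "2 * s < N"
  using assms by (auto simp: non_all_to_all_def field_simps)

text \<open>
  The neighbours of cell \<open>l\<close> are the cells \<open>l \<plusminus> m\<close> with \<open>1 \<le> m \<le> s\<close>, wrapped around the ring.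
  Because \<open>2 s < N\<close> the two sides do not overlap, so wrapping is a bijection; it does not change
  the values of a function of period \<open>N\<close>.
\<close>
lemma ring_neighbour_sum:
  fixes g :: "int \<Rightarrow> 'a :: comm_monoid_add"
  assumes per: "\<And>x. g (x + int N) = g x" and s: "2 * s < N" and l: "l \<in> {1..N}"
  shows "(\<Sum>k | k \<in> {1..N} \<and> 1 \<le> ring_dist N l k \<and> ring_dist N l k \<le> int s. g (int k)) =
    (\<Sum>m=1..s. g (int l + int m) + g (int l - int m))"
proof -
  have per': "g (x - int N) = g x" for x using per[of "x - int N"] by simp
  let ?S = "{k. k \<in> {1..N} \<and> 1 \<le> ring_dist N l k \<and> ring_dist N l k \<le> int s}"
  \<comment> \<open>A cell whose label differs from \<open>l\<close> by more than \<open>s\<close> can be a neighbour only across the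
    junction of \<open>N\<close> and 1, and then its unwrapped position is one period away.\<close>
  let ?wrap = "\<lambda>x. nat (if x < 1 then x + int N else if x > int N then x - int N else x)"
  let ?unwrap = "\<lambda>k. if int k - int l > int s then int k - int N
    else if int l - int k > int s then int k + int N else int k"
  have "(\<Sum>k\<in>?S. g (int k)) = (\<Sum>x\<in>{int l + 1..int l + int s} \<union> {int l - int s..int l - 1}. g x)"
    by (rule sum.reindex_bij_witness[of _ ?wrap ?unwrap])
       (use s l in \<open>auto simp: ring_dist_def per per' split: if_splits\<close>)
  also have "\<dots> = sum g {int l + 1..int l + int s} + sum g {int l - int s..int l - 1}"
    by (rule sum.union_disjoint) auto
  also have "sum g {int l + 1..int l + int s} = (\<Sum>m=1..s. g (int l + int m))"
    by (rule sum.reindex_bij_witness[of _ "\<lambda>m. int l + int m" "\<lambda>x. nat (x - int l)"]) auto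
  also have "sum g {int l - int s..int l - 1} = (\<Sum>m=1..s. g (int l - int m))"
    by (rule sum.reindex_bij_witness[of _ "\<lambda>m. int l - int m" "\<lambda>x. nat (int l - x)"]) auto
  finally show ?thesis by (simp add: sum.distrib)
qed

lemma ring_coupling_sum:
  fixes g :: "int \<Rightarrow> 'a :: real_algebra_1"
  assumes "\<And>x. g (x + int N) = g x" "2 * s < N" "l \<in> {1..N}"
  shows "(\<Sum>k=1..N. of_real (ring_coupling N s l k) * g (int k)) =
    (\<Sum>m=1..s. g (int l + int m) + g (int l - int m))"
  unfolding ring_neighbour_sum[of g, OF assms, symmetric]
  by (rule sum.mono_neutral_cong_right) (auto simp: ring_coupling_def)

lemma ring_coupling_self [simp]: "ring_coupling N s l l = 0"
  by (simp add: ring_coupling_def ring_dist_def)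

lemma ring_degree:
  assumes "2 * s < N" "l \<in> {1..N}"
  shows "(\<Sum>k=1..N. ring_coupling N s l k) = 2 * real s"
  using ring_coupling_sum[of "\<lambda>_. 1 :: real", OF _ assms] by simp

text \<open>
  This is \<open>w\<^sup>f\<^sup>x\<close> for the root of unity \<open>w = e\<^sup>-\<^sup>2\<^sup>\<pi>\<^sup>\<i>\<^sup>/\<^sup>N\<close>. The position \<open>x\<close> is an integer because
  the neighbours of a cell are reached by leaving the range of labels on either side.
\<close>
definition fourier_mode :: "nat \<Rightarrow> nat \<Rightarrow> int \<Rightarrow> complex" where
  "fourier_mode N f x = cis (- (2 * pi * real f * of_int x / real N))"

lemma root_w_power: "root_w N ^ (f * n) = fourier_mode N f (int n)"
proof -
  have "root_w N = cis (- (2 * pi / real N))"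
    by (simp add: root_w_def cis_conv_exp mult.commute)
  then have "root_w N ^ (f * n) = cis (real (f * n) * - (2 * pi / real N))"
    by (simp add: Complex.DeMoivre)
  also have "real (f * n) * - (2 * pi / real N) = - (2 * pi * real f * of_int (int n) / real N)"
    by simp
  finally show ?thesis by (simp only: fourier_mode_def)
qed

lemma fourier_mode_periodic:
  assumes "0 < N"
  shows "fourier_mode N f (x + int N) = fourier_mode N f x"
proof -
  have "- (2 * pi * real f * of_int (x + int N) / real N) =
      - (2 * pi * real f * of_int x / real N) + - (2 * pi * real f)"
    using assms by (simp add: field_simps)
  then have "fourier_mode N f (x + int N) =
      cis (- (2 * pi * real f * of_int x / real N)) * cis (- (2 * pi * real f))"
    by (simp only: fourier_mode_def cis_mult)
  also have "cis (- (2 * pi * real f)) = 1"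
    using cis_multiple_2pi[of "- real f"] by simp
  finally show ?thesis by (simp add: fourier_mode_def)
qed

text \<open>
  This is \<open>c\<close> times the eigenvalue of the graph Laplacian of the ring for frequency \<open>f\<close>, and so
  the amount by which the coupling shifts the growth rate of that mode down. The block with
  index \<open>j\<close> has frequency \<open>f = j - 1\<close>.
\<close>
definition coupling_shift :: "nat \<Rightarrow> nat \<Rightarrow> real \<Rightarrow> nat \<Rightarrow> real" where
  "coupling_shift N s c f = 2 * c * (\<Sum>m=1..s. 1 - cos (2 * pi * real f * real m / real N))"

text \<open>
  The neighbours at distance \<open>m\<close> contribute the mode times \<open>e\<^sup>-\<^sup>\<i>\<^sup>u + e\<^sup>\<i>\<^sup>u = 2 cos u\<close>, where
  \<open>u = 2 \<pi> f m / N\<close>. This factor does not depend on the cell.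
\<close>
lemma fourier_mode_eigenvector:
  assumes "2 * s < N" "l \<in> {1..N}"
  shows "complex_of_real c *
      (\<Sum>k=1..N. of_real (ring_coupling N s l k) * fourier_mode N f (int k - 1)) =
    of_real (2 * real s * c - coupling_shift N s c f) * fourier_mode N f (int l - 1)"
proof -
  have "fourier_mode N f (x + int N - 1) = fourier_mode N f (x - 1)" for x
    using fourier_mode_periodic[of N f "x - 1"] assms by (simp add: algebra_simps)
  then have "(\<Sum>k=1..N. of_real (ring_coupling N s l k) * fourier_mode N f (int k - 1)) =
    (\<Sum>m=1..s. fourier_mode N f (int l + int m - 1) + fourier_mode N f (int l - int m - 1))"
    using ring_coupling_sum[of "\<lambda>x. fourier_mode N f (x - 1)" N s l] assms by simp
  also have "\<dots> = (\<Sum>m=1..s. of_real (2 * cos (2 * pi * real f * real m / real N)) *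
      fourier_mode N f (int l - 1))"
  proof (rule sum.cong, rule refl)
    fix m
    let ?u = "2 * pi * real f * real m / real N"
    let ?v = "- (2 * pi * real f * of_int (int l - 1) / real N)"
    have *: "fourier_mode N f (int l + int m - 1) = cis (?v - ?u)"
        "fourier_mode N f (int l - int m - 1) = cis (?v + ?u)"
      unfolding fourier_mode_def
      by (rule arg_cong[of _ _ cis], simp add: diff_divide_distrib add_divide_distrib algebra_simps)+
    show "fourier_mode N f (int l + int m - 1) + fourier_mode N f (int l - int m - 1) =
        of_real (2 * cos ?u) * fourier_mode N f (int l - 1)"
      unfolding * unfolding fourier_mode_def
      by (simp add: complex_eq_iff cos_add cos_diff sin_add sin_diff)
  qed
  finally show ?thesis
    by (simp add: coupling_shift_def sum_subtractf sum_distrib_left sum_distrib_right algebra_simps)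
qed

lemma coupling_shift_0 [simp]: "coupling_shift N s c 0 = 0"
  by (simp add: coupling_shift_def)

text \<open>
  All summands are nonnegative, and the one for \<open>m = 1\<close> is positive since \<open>f / N\<close> is not an
  integer.
\<close>
lemma coupling_shift_pos:
  assumes "0 < c" "1 \<le> s" "0 < f" "f < N"
  shows "0 < coupling_shift N s c f"
proof -
  have "cos (2 * pi * real f * real 1 / real N) \<noteq> 1"
  proof
    assume "cos (2 * pi * real f * real 1 / real N) = 1"
    then obtain k :: int where "2 * pi * real f / real N = of_int k * 2 * pi"
      by (auto simp: cos_one_2pi_int)
    then have "real f = of_int k * real N" using assms by (simp add: field_simps)
    then have "int f = k * int N" by (metis of_int_eq_iff of_int_mult of_int_of_nat_eq)
    then have "int N dvd int f" by simp
    then show False using assms by (auto dest: dvd_imp_le)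
  qed
  then have "0 < 1 - cos (2 * pi * real f * real 1 / real N)"
    using cos_le_one[of "2 * pi * real f * real 1 / real N"] by linarith
  then have "0 < (\<Sum>m=1..s. 1 - cos (2 * pi * real f * real m / real N))"
    using assms by (intro sum_pos2[of _ 1]) auto
  then show ?thesis using assms by (simp add: coupling_shift_def)
qed

lemma coupling_shift_reflect:
  assumes "f \<le> N" "0 < N"
  shows "coupling_shift N s c (N - f) = coupling_shift N s c f"
proof -
  have "cos (2 * pi * real (N - f) * real m / real N) = cos (2 * pi * real f * real m / real N)" for m
  proof -
    have "2 * pi * real (N - f) * real m / real N =
        2 * pi * real m - 2 * pi * real f * real m / real N"
      using assms by (simp add: of_nat_diff field_simps)
    moreover have "cos (2 * pi * real m) = 1" "sin (2 * pi * real m) = 0"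
      using cos_int_2pin[of "int m"] sin_int_2pin[of "int m"] by simp_all
    ultimately show ?thesis by (simp add: cos_diff)
  qed
  then show ?thesis by (simp add: coupling_shift_def)
qed

text \<open>
  The Dirichlet kernel. Products of a sine and a cosine become differences of sines, and then the
  sum telescopes.
\<close>
lemma sin_mult_sum_cos:
  "sin (x / 2) * (\<Sum>m=1..s. cos (real m * x)) = sin (real s * x / 2) * cos ((real s + 1) * x / 2)"
    for x :: real
proof (induction s)
  case (Suc s)
  have *: "sin (real k * x / 2) * cos ((real k + 1) * x / 2) =
      (sin (real k * x + x / 2) - sin (x / 2)) / 2" for k
  proof -
    have "real k * x / 2 + (real k + 1) * x / 2 = real k * x + x / 2"
      "real k * x / 2 - (real k + 1) * x / 2 = - (x / 2)"
      by (simp_all add: field_simps)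
    then show ?thesis by (simp only: sin_times_cos sin_minus) simp
  qed
  have "x / 2 + real (Suc s) * x = real (Suc s) * x + x / 2"
    "x / 2 - real (Suc s) * x = - (real s * x + x / 2)"
    by (simp_all add: field_simps)
  then have "sin (x / 2) * cos (real (Suc s) * x) =
      (sin (real (Suc s) * x + x / 2) - sin (real s * x + x / 2)) / 2"
    by (simp only: sin_times_cos sin_minus) simp
  moreover have "sin (x / 2) * (\<Sum>m=1..Suc s. cos (real m * x)) =
      sin (x / 2) * (\<Sum>m=1..s. cos (real m * x)) + sin (x / 2) * cos (real (Suc s) * x)"
    by (simp add: distrib_left)
  ultimately show ?case
    unfolding * Suc by argo
qed simp

lemma critical_mu_eq_coupling_shift:
  assumes "j \<in> {2..N}"
  shows "critical_mu N s c j = coupling_shift N s c (j - 1)"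
proof -
  let ?x = "2 * ((real j - 1) * pi / real N)"
  have "real j - 1 < real N" using assms by auto
  then have "(real j - 1) * pi < pi * real N" by (simp add: mult.commute)
  then have "0 < ?x / 2" "?x / 2 < pi" using assms by (auto simp: divide_less_eq)
  then have "sin (?x / 2) \<noteq> 0" using sin_gt_zero[of "?x / 2"] by linarith
  then have "(\<Sum>m=1..s. cos (real m * ?x)) =
      sin (real s * ?x / 2) * cos ((real s + 1) * ?x / 2) / sin (?x / 2)"
    using sin_mult_sum_cos[of ?x s] by (simp add: field_simps)
  moreover have "real m * ?x = 2 * pi * real (j - 1) * real m / real N" for m
    using assms by (simp add: of_nat_diff)
  moreover have "real s * ?x / 2 = real s * (real j - 1) * pi / real N"
      "(real s + 1) * ?x / 2 = (real s + 1) * (real j - 1) * pi / real N"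
      "?x / 2 = (real j - 1) * pi / real N"
    by simp_all
  ultimately show ?thesis
    by (simp only: critical_mu_def coupling_shift_def sum_subtractf) simp
qed

section \<open>The Fourier blocks\<close>

lemma mat_adjoint_carrier:
  "A \<in> carrier_mat n m \<Longrightarrow> mat_adjoint A \<in> carrier_mat m n"
  by (auto simp: mat_adjoint_def intro!: carrier_matI)

lemma mat_adjoint_index:
  "i < dim_col A \<Longrightarrow> j < dim_row A \<Longrightarrow> mat_adjoint A $$ (i, j) = conjugate (A $$ (j, i))"
  by (simp add: mat_adjoint_def mat_of_rows_index)

lemma sum_upto_double:
  fixes g :: "nat \<Rightarrow> 'a :: comm_monoid_add"
  shows "(\<Sum>k<2 * n. g k) = (\<Sum>l<n. g (2 * l) + g (2 * l + 1))"
  by (induction n) (simp_all add: add.assoc)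

lemma F2_carrier [simp]: "F2 \<in> carrier_mat 2 2"
  by (intro carrier_matI) (simp_all add: F2_def mat_of_rows_list_def)

lemma F2_dim [simp]: "dim_row F2 = 2" "dim_col F2 = 2"
  using F2_carrier by (blast dest: carrier_matD)+

lemma F2_index:
  "p < 2 \<Longrightarrow> q < 2 \<Longrightarrow>
     F2 $$ (p, q) = complex_of_real (if p = 1 \<and> q = 1 then - (1 / sqrt 2) else 1 / sqrt 2)"
  by (auto simp: F2_def mat_of_rows_list_def less_2_nat)

lemma inverse_sqrt_2_sq: "complex_of_real (1 / sqrt 2) * complex_of_real (1 / sqrt 2) = 1 / 2"
  by (simp flip: of_real_mult)

text \<open>
  \<open>F\<^sub>2\<close> is a reflection of the plane, hence reverses the orientation of a rotation.
\<close>
lemma F2_conjugation: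
  "mat_adjoint F2 * scaled_rotation a b * F2 = scaled_rotation a (- b)"
proof (rule eq_matI)
  fix p q assume "p < dim_row (scaled_rotation a (- b))" "q < dim_col (scaled_rotation a (- b))"
  then have pq: "p < 2" "q < 2" by simp_all
  define h where "h = complex_of_real (1 / sqrt 2)"
  have h: "h * (h * x) = x / 2" "h * (x * h) = x / 2" "cnj h = h" for x
    using inverse_sqrt_2_sq by (simp_all add: h_def field_simps)
  have F: "F2 $$ (p, q) = (if p = 1 \<and> q = 1 then - h else h)" if "p < 2" "q < 2" for p q
    using that by (simp add: F2_index h_def)
  have adj: "mat_adjoint F2 \<in> carrier_mat 2 2"
    by (rule mat_adjoint_carrier) simp
  have index: "mat_adjoint F2 $$ (p, q) = (if p = 1 \<and> q = 1 then - h else h)"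
    if "p < 2" "q < 2" for p q
    using that by (simp add: mat_adjoint_index F h(3))
  show "(mat_adjoint F2 * scaled_rotation a b * F2) $$ (p, q) = scaled_rotation a (- b) $$ (p, q)"
    using pq adj h(1,2)
    by (auto simp: less_2_nat times_mat_def scalar_prod_def numeral_2_eq_2 index F algebra_simps)
qed (auto simp: mat_adjoint_carrier[OF F2_carrier, THEN carrier_matD(1)])

lemma A_block_eq:
  "A_block N s c \<omega> \<mu> k = scaled_rotation
     (of_real ((if k = 1 then \<mu> - 2 * real s * c else 0) + c * ring_coupling N s 1 k))
     (of_real (if k = 1 then \<omega> else 0))"
  by (rule eq_matI)
     (auto simp: A_block_def mat_of_rows_list_def less_2_nat)

lemma B_block_eq:
  "B_block N s c \<omega> \<mu> m = scaled_rotation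
     (of_real ((if m = 0 then \<mu> - 2 * real s * c else 0) + c * ring_coupling N s 1 (m + 1)))
     (of_real (if m = 0 then - \<omega> else 0))"
  unfolding B_block_def A_block_eq F2_conjugation by (rule arg_cong2) auto

text \<open>
  The block \<open>A\<^sub>1\<close> contributes the same rotation for every frequency, since \<open>w\<^sup>0 = 1\<close>. The other
  blocks sum to the eigenvalue of the coupling, obtained by evaluating
  \<open>fourier_mode_eigenvector\<close> at the first cell.
\<close>
lemma fourier_block_eq:
  assumes "2 * s < N"
  shows "fourier_block N s c \<omega> \<mu> j =
    scaled_rotation (of_real (\<mu> - coupling_shift N s c (j - 1))) (of_real (- \<omega>))"
proof -
  let ?f = "j - 1"
  let ?w = "\<lambda>k. fourier_mode N ?f (int k - 1)"
  have N: "1 \<in> {1..N}" using assms by auto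
  have one: "?w 1 = 1" by (simp add: fourier_mode_def)
  have w: "root_w N ^ (?f * (k - 1)) = ?w k" if "k \<in> {1..N}" for k
    using that by (simp add: root_w_power of_nat_diff)
  have "(\<Sum>k=1..N. ?w k * of_real ((if k - 1 = 0 then \<mu> - 2 * real s * c else 0) +
        c * ring_coupling N s 1 (k - 1 + 1))) =
      (\<Sum>k=1..N. (if k = 1 then ?w k * of_real (\<mu> - 2 * real s * c) else 0) +
        of_real c * (of_real (ring_coupling N s 1 k) * ?w k))"
    by (rule sum.cong) (auto simp: algebra_simps)
  also have "\<dots> = ?w 1 * of_real (\<mu> - 2 * real s * c) +
      of_real (2 * real s * c - coupling_shift N s c ?f) * ?w 1"
    unfolding sum.distrib sum.delta[OF finite_atLeastAtMost] sum_distrib_left[symmetric]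
      fourier_mode_eigenvector[OF assms N] using N by simp
  also have "\<dots> = of_real (\<mu> - coupling_shift N s c ?f)"
    by (simp only: one) simp
  finally have a: "(\<Sum>k=1..N. ?w k * of_real ((if k - 1 = 0 then \<mu> - 2 * real s * c else 0) +
        c * ring_coupling N s 1 (k - 1 + 1))) = of_real (\<mu> - coupling_shift N s c ?f)" .
  have "(\<Sum>k=1..N. ?w k * of_real (if k - 1 = 0 then - \<omega> else 0)) =
      (\<Sum>k=1..N. if k = 1 then ?w k * of_real (- \<omega>) else 0)"
    by (rule sum.cong) auto
  also have "\<dots> = of_real (- \<omega>)"
    unfolding sum.delta[OF finite_atLeastAtMost] one using N by simp
  finally have b: "(\<Sum>k=1..N. ?w k * of_real (if k - 1 = 0 then - \<omega> else 0)) = of_real (- \<omega>)" .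
  show ?thesis
  proof (rule eq_matI)
    fix p q assume "p < dim_row (scaled_rotation (of_real (\<mu> - coupling_shift N s c ?f)) (of_real (- \<omega>)))"
      "q < dim_col (scaled_rotation (of_real (\<mu> - coupling_shift N s c ?f)) (of_real (- \<omega>)))"
    then have pq: "p < 2" "q < 2" by simp_all
    then have "fourier_block N s c \<omega> \<mu> j $$ (p, q) =
        (\<Sum>k=1..N. ?w k * B_block N s c \<omega> \<mu> (k - 1) $$ (p, q))"
      using w by (auto simp: fourier_block_def intro!: sum.cong)
    also have "\<dots> = scaled_rotation (of_real (\<mu> - coupling_shift N s c ?f)) (of_real (- \<omega>)) $$ (p, q)"
      unfolding a[symmetric] b[symmetric] B_block_eq scaled_rotation_index[OF pq]
      by (simp add: sum_negf[symmetric] del: sum_negf)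
    finally show "fourier_block N s c \<omega> \<mu> j $$ (p, q) =
      scaled_rotation (of_real (\<mu> - coupling_shift N s c ?f)) (of_real (- \<omega>)) $$ (p, q)" .
  qed (simp_all add: fourier_block_def)
qed

section \<open>The Jacobian at the origin\<close>

definition network_linearization ::
  "nat \<Rightarrow> nat \<Rightarrow> real \<Rightarrow> real \<Rightarrow> real \<Rightarrow> nat \<Rightarrow> nat \<Rightarrow> real" where
  "network_linearization N s c \<omega> \<mu> i j =
     (if i mod 2 = j mod 2 then
        (if i div 2 = j div 2 then \<mu> - 2 * real s * c else 0)
        + c * ring_coupling N s (i div 2 + 1) (j div 2 + 1)
      else if i div 2 = j div 2 then (if even i then - \<omega> else \<omega>) else 0)"

lemma deriv_linear_cubic: "deriv (\<lambda>t. a * t - b * t ^ 3) 0 = (a :: real)"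
proof (rule DERIV_imp_deriv)
  show "((\<lambda>t. a * t - b * t ^ 3) has_field_derivative a) (at 0)"
    by (auto intro!: derivative_eq_intros)
qed

text \<open>
  On a coordinate axis at most one coordinate is nonzero, so the cubic terms reduce to \<open>t\<^sup>3\<close> in
  the component along the axis. The diagonal loses \<open>2 s c\<close> because every cell has \<open>2 s\<close>
  neighbours.
\<close>
lemma network_field_on_axis:
  assumes s: "2 * s < N" and i: "i < 2 * N" and j: "j < 2 * N"
  shows "network_field N s c \<omega> \<mu> ((\<lambda>_. 0)(j := t)) i =
    network_linearization N s c \<omega> \<mu> i j * t - of_bool (i = j) * t ^ 3"
proof -
  let ?z = "(\<lambda>_. 0 :: real)(j := t)"
  let ?l = "i div 2 + 1" and ?m = "j div 2 + 1"
  have l: "?l \<in> {1..N}" and m: "?m \<in> {1..N}" using i j by auto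
  have x: "x_of ?z k = (if even j \<and> k = ?m then t else 0)" if "k \<in> {1..N}" for k
    using that by (auto simp: x_of_def elim!: evenE)
  have y: "y_of ?z k = (if odd j \<and> k = ?m then t else 0)" if "k \<in> {1..N}" for k
    using that by (auto simp: y_of_def elim!: oddE)
  \<comment> \<open>Used with \<open>v\<close> the vector of all \<open>x\<close> or of all \<open>y\<close> coordinates; \<open>P\<close> tells whether the axis
    belongs to these coordinates.\<close>
  have coupling: "(\<Sum>k=1..N. ring_coupling N s ?l k * (v k - v ?l)) =
      (if P then ring_coupling N s ?l ?m * t else 0) - 2 * real s * v ?l"
    if v: "\<And>k. k \<in> {1..N} \<Longrightarrow> v k = (if P \<and> k = ?m then t else 0)" for v P
  proof -
    have "(\<Sum>k=1..N. ring_coupling N s ?l k * (v k - v ?l)) =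
        (\<Sum>k=1..N. if k = ?m then (if P then ring_coupling N s ?l k * t else 0) else 0)
        - (\<Sum>k=1..N. ring_coupling N s ?l k) * v ?l"
      unfolding sum_distrib_right sum_subtractf[symmetric]
      by (rule sum.cong) (auto simp: v algebra_simps)
    then show ?thesis
      using m by (simp only: ring_degree[OF s l] sum.delta[OF finite_atLeastAtMost]) simp
  qed
  have same_parity: "i mod 2 = j mod 2 \<longleftrightarrow> even i = even j"
    by (simp add: mod2_eq_if)
  have cx: "(\<Sum>k=1..N. ring_coupling N s ?l k * (x_of ?z k - x_of ?z ?l)) =
      (if even j then ring_coupling N s ?l ?m * t else 0) - 2 * real s * x_of ?z ?l"
    by (rule coupling, rule x)
  have cy: "(\<Sum>k=1..N. ring_coupling N s ?l k * (y_of ?z k - y_of ?z ?l)) =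
      (if odd j then ring_coupling N s ?l ?m * t else 0) - 2 * real s * y_of ?z ?l"
    by (rule coupling, rule y)
  show ?thesis
  proof (cases "i div 2 = j div 2")
    case True
    then have diag: "i = j \<longleftrightarrow> even i = even j"
      by (metis mod_mult_div_eq mod2_eq_if)
    show ?thesis
      unfolding network_field_def x_dot_def y_dot_def
      unfolding cx cy
      unfolding x[OF l] y[OF l]
      unfolding network_linearization_def same_parity diag True
      by (cases "even i"; cases "even j") (simp_all add: power2_eq_square power3_eq_cube algebra_simps)
  next
    case False
    then have "i \<noteq> j" "?l \<noteq> ?m" by auto
    with False show ?thesis
      unfolding network_field_def x_dot_def y_dot_def
      unfolding cx cy
      unfolding x[OF l] y[OF l]
      unfolding network_linearization_def same_parity
      by (cases "even i"; cases "even j") simp_all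
  qed
qed

lemma network_jacobian_carrier: "network_jacobian N s c \<omega> \<mu> \<in> carrier_mat (2 * N) (2 * N)"
  by (simp add: network_jacobian_def jacobian_def)

lemma network_jacobian_index:
  assumes "2 * s < N" "i < 2 * N" "j < 2 * N"
  shows "network_jacobian N s c \<omega> \<mu> $$ (i, j) =
    of_real (network_linearization N s c \<omega> \<mu> i j)"
  using assms
  by (simp add: network_jacobian_def jacobian_def network_field_on_axis deriv_linear_cubic)

section \<open>Unitary block diagonalization\<close>

text \<open>
  For \<open>a \<noteq> b\<close> this is a geometric sum over powers of an \<open>N\<close>-th root of unity other than 1.
\<close>
lemma fourier_mode_orthogonal:
  assumes "a < N" "b < N"
  shows "(\<Sum>k<N. fourier_mode N k (int a) * cnj (fourier_mode N k (int b))) =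
    (if a = b then of_nat N else 0)"
proof -
  let ?x = "2 * pi * (real b - real a) / real N"
  have N: "0 < N" using assms by simp
  have "fourier_mode N k (int a) * cnj (fourier_mode N k (int b)) = cis ?x ^ k" for k
    unfolding fourier_mode_def cis_cnj cis_mult Complex.DeMoivre
    by (rule arg_cong[of _ _ cis]) (use N in \<open>simp add: field_simps\<close>)
  then have sum: "(\<Sum>k<N. fourier_mode N k (int a) * cnj (fourier_mode N k (int b))) =
      (\<Sum>k<N. cis ?x ^ k)" by simp
  show ?thesis
  proof (cases "a = b")
    case True
    then show ?thesis using sum by simp
  next
    case False
    have "cis ?x \<noteq> 1"
    proof
      assume "cis ?x = 1"
      then have "cos ?x = 1" by (simp add: complex_eq_iff)
      then obtain n :: int where "?x = of_int n * 2 * pi" by (auto simp: cos_one_2pi_int)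
      then have "2 * pi * (real b - real a) = 2 * pi * (of_int n * real N)"
        using N by (simp add: field_simps)
      then have "real b - real a = of_int n * real N"
        by (subst (asm) mult_left_cancel) auto
      then have "real_of_int (int b - int a) = real_of_int (n * int N)" by simp
      then have "int b - int a = n * int N" by (simp only: of_int_eq_iff)
      then have "int N dvd int b - int a" by simp
      moreover have "int b - int a \<noteq> 0" using False by simp
      ultimately have "\<bar>int N\<bar> \<le> \<bar>int b - int a\<bar>" by (intro dvd_imp_le_int)
      then show False using assms by linarith
    qed
    moreover have "cis ?x ^ N = 1"
      using N cis_multiple_2pi[of "real b - real a"]
      by (simp add: Complex.DeMoivre)
    ultimately show ?thesis using False by (simp add: sum geometric_sum)
  qed
qed

text \<open>
  The Kronecker product of the unitary discrete Fourier matrix with \<open>F\<^sub>2\<close>: index \<open>i\<close> stands for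
  cell \<open>i div 2\<close> (counted from 0) and coordinate \<open>i mod 2\<close>.
\<close>
definition fourier_kron :: "nat \<Rightarrow> complex mat" where
  "fourier_kron N = mat (2 * N) (2 * N) (\<lambda>(i, j).
     of_real (1 / sqrt (real N)) * fourier_mode N (j div 2) (int (i div 2)) * F2 $$ (i mod 2, j mod 2))"

lemma fourier_kron_carrier [simp]: "fourier_kron N \<in> carrier_mat (2 * N) (2 * N)"
  by (simp add: fourier_kron_def)

lemma fourier_kron_dim [simp]:
  "dim_row (fourier_kron N) = 2 * N" "dim_col (fourier_kron N) = 2 * N"
  by (simp_all add: fourier_kron_def)

lemma times_mat_index_sum:
  "A \<in> carrier_mat n n \<Longrightarrow> B \<in> carrier_mat n n \<Longrightarrow> i < n \<Longrightarrow> j < n \<Longrightarrow>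
     (A * B) $$ (i, j) = (\<Sum>k<n. A $$ (i, k) * B $$ (k, j))"
  by (simp add: scalar_prod_def atLeast0LessThan)

lemma F2_rows:
  assumes "p < 2" "q < 2"
  shows "F2 $$ (p, 0) * cnj (F2 $$ (q, 0)) + F2 $$ (p, 1) * cnj (F2 $$ (q, 1)) = of_bool (p = q)"
  using assms inverse_sqrt_2_sq by (auto simp: F2_index less_2_nat)

lemma fourier_kron_unitary:
  assumes "0 < N"
  shows "fourier_kron N * mat_adjoint (fourier_kron N) = 1\<^sub>m (2 * N)"
proof (rule eq_matI)
  fix i j assume "i < dim_row (1\<^sub>m (2 * N) :: complex mat)" "j < dim_col (1\<^sub>m (2 * N) :: complex mat)"
  then have ij: "i < 2 * N" "j < 2 * N" by simp_all
  let ?U = "fourier_kron N"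
  let ?g = "\<lambda>l. fourier_mode N l (int (i div 2)) * cnj (fourier_mode N l (int (j div 2)))"
  have n: "complex_of_real (1 / sqrt (real N)) * complex_of_real (1 / sqrt (real N)) = 1 / of_nat N"
    by (simp flip: of_real_mult)
  have "(?U * mat_adjoint ?U) $$ (i, j) = (\<Sum>k<2 * N. ?U $$ (i, k) * mat_adjoint ?U $$ (k, j))"
    using ij by (intro times_mat_index_sum mat_adjoint_carrier) auto
  also have "\<dots> = (\<Sum>k<2 * N. ?U $$ (i, k) * cnj (?U $$ (j, k)))"
    using ij by (intro sum.cong refl) (simp add: mat_adjoint_index fourier_kron_def)
  also have "\<dots> = (\<Sum>l<N. 1 / of_nat N * ?g l *
      (F2 $$ (i mod 2, 0) * cnj (F2 $$ (j mod 2, 0)) + F2 $$ (i mod 2, 1) * cnj (F2 $$ (j mod 2, 1))))"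
    unfolding sum_upto_double n[symmetric]
    using ij by (intro sum.cong refl) (simp add: fourier_kron_def, simp add: algebra_simps add_divide_distrib)
  also have "\<dots> = 1 / of_nat N * (\<Sum>l<N. ?g l) * of_bool (i mod 2 = j mod 2)"
    by (subst F2_rows) (simp_all add: sum_distrib_left sum_distrib_right)
  also have "(\<Sum>l<N. ?g l) = (if i div 2 = j div 2 then of_nat N else 0)"
    using ij by (intro fourier_mode_orthogonal) auto
  also have "1 / of_nat N * (if i div 2 = j div 2 then of_nat N else 0) * of_bool (i mod 2 = j mod 2) =
      (of_bool (i = j) :: complex)"
  proof -
    have "i = j \<longleftrightarrow> i div 2 = j div 2 \<and> i mod 2 = j mod 2" by (metis mod_mult_div_eq)
    then show ?thesis using assms by auto
  qed
  finally show "(?U * mat_adjoint ?U) $$ (i, j) = 1\<^sub>m (2 * N) $$ (i, j)"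
    using ij by simp
qed (simp_all add: mat_adjoint_carrier[OF fourier_kron_carrier, THEN carrier_matD(1)]
      mat_adjoint_carrier[OF fourier_kron_carrier, THEN carrier_matD(2)] fourier_kron_carrier[THEN carrier_matD(1)])

abbreviation (input) fourier_diag :: "nat \<Rightarrow> nat \<Rightarrow> real \<Rightarrow> real \<Rightarrow> real \<Rightarrow> complex mat" where
  "fourier_diag N s c \<omega> \<mu> \<equiv> diag_block_mat (map (fourier_block N s c \<omega> \<mu>) [1..<N + 1])"

lemma fourier_block_carrier: "fourier_block N s c \<omega> \<mu> j \<in> carrier_mat 2 2"
  by (simp add: fourier_block_def)

lemma fourier_diag_carrier: "fourier_diag N s c \<omega> \<mu> \<in> carrier_mat (2 * N) (2 * N)"
proof -
  have "fourier_diag N s c \<omega> \<mu> \<in> carrier_mat (2 * length (map (fourier_block N s c \<omega> \<mu>) [1..<N + 1]))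
      (2 * length (map (fourier_block N s c \<omega> \<mu>) [1..<N + 1]))"
    by (rule diag_block_mat_2_carrier) (auto simp only: set_map fourier_block_carrier)
  then show ?thesis by (simp only: length_map length_upt add_diff_cancel_right')
qed

lemma fourier_diag_index:
  assumes "2 * s < N" "i < 2 * N" "j < 2 * N"
  shows "fourier_diag N s c \<omega> \<mu> $$ (i, j) =
    (if i div 2 = j div 2 then
       scaled_rotation (of_real (\<mu> - coupling_shift N s c (j div 2))) (of_real (- \<omega>)) $$ (i mod 2, j mod 2)
     else 0)"
  using assms
  by (subst diag_block_mat_2_index)
     (auto simp: fourier_block_carrier fourier_block_eq less_mult_imp_div_less mult.commute simp del: upt_Suc)

lemma one_less_two_nat: "(1 :: nat) < 2"
  by simp

text \<open>
  The columns belonging to one frequency form a Fourier mode in the cell index times \<open>F\<^sub>2\<close> in the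
  coordinate index. The coupling acts on the first factor only, by a scalar, and the local
  rotation on the second, where \<open>F\<^sub>2\<close> reverses it.
\<close>
lemma jacobian_intertwined:
  assumes s: "2 * s < N"
  shows "network_jacobian N s c \<omega> \<mu> * fourier_kron N = fourier_kron N * fourier_diag N s c \<omega> \<mu>"
    (is "?J * ?U = ?U * ?D")
proof (rule eq_matI)
  fix i j assume "i < dim_row (?U * ?D)" "j < dim_col (?U * ?D)"
  then have ij: "i < 2 * N" "j < 2 * N"
    using fourier_diag_carrier[of N s c \<omega> \<mu>] fourier_kron_carrier[of N] by auto
  let ?a = "i div 2" and ?p = "i mod 2" and ?f = "j div 2" and ?q = "j mod 2"
  have pq: "?p < 2" "?q < 2" by simp_all
  have a: "?a < N" and f: "?f < N" using ij by auto
  define r where "r = complex_of_real (1 / sqrt (real N))"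
  define v where "v l = r * fourier_mode N ?f (int l)" for l
  define \<eta> where "\<eta> = complex_of_real (\<mu> - coupling_shift N s c ?f)"
  have U: "?U $$ (2 * l + p, j) = v l * F2 $$ (p, ?q)" if "l < N" "p < 2" for l p
    using that ij by (simp add: fourier_kron_def v_def r_def)
  have U': "?U $$ (i, 2 * l + p) = r * fourier_mode N l (int ?a) * F2 $$ (?p, p)" if "l < N" "p < 2" for l p
    using that ij by (simp add: fourier_kron_def r_def)
  have shift: "of_real c * (\<Sum>l<N. of_real (ring_coupling N s (?a + 1) (l + 1)) * v l) =
      of_real (2 * real s * c - coupling_shift N s c ?f) * v ?a"
  proof -
    have "(\<Sum>l<N. of_real (ring_coupling N s (?a + 1) (l + 1)) * v l) =
        (\<Sum>k=1..N. of_real (ring_coupling N s (?a + 1) k) * v (k - 1))"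
      by (rule sum.reindex_bij_witness[of _ "\<lambda>k. k - 1" Suc]) auto
    also have "\<dots> = r * (\<Sum>k=1..N. of_real (ring_coupling N s (?a + 1) k) * fourier_mode N ?f (int k - 1))"
      unfolding sum_distrib_left by (rule sum.cong) (auto simp: v_def of_nat_diff)
    finally have "of_real c * (\<Sum>l<N. of_real (ring_coupling N s (?a + 1) (l + 1)) * v l) = r *
        (of_real c * (\<Sum>k=1..N. of_real (ring_coupling N s (?a + 1) k) * fourier_mode N ?f (int k - 1)))"
      by (simp only: mult.left_commute)
    also have "\<dots> = r * (of_real (2 * real s * c - coupling_shift N s c ?f) * fourier_mode N ?f (int (?a + 1) - 1))"
      using a by (subst fourier_mode_eigenvector[OF s]) auto
    finally show ?thesis by (simp add: v_def)
  qed
  have "(?J * ?U) $$ (i, j) = (\<Sum>k<2 * N. ?J $$ (i, k) * ?U $$ (k, j))"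
    using ij by (intro times_mat_index_sum network_jacobian_carrier) auto
  also have "\<dots> = (\<Sum>l<N. ?J $$ (i, 2 * l + 0) * ?U $$ (2 * l + 0, j) +
      ?J $$ (i, 2 * l + 1) * ?U $$ (2 * l + 1, j))"
    unfolding sum_upto_double by simp
  also have "\<dots> = (\<Sum>l<N.
      (if l = ?a then v l * (of_real (\<mu> - 2 * real s * c) * F2 $$ (?p, ?q) +
          (if even i then - of_real \<omega> * F2 $$ (1, ?q) else of_real \<omega> * F2 $$ (0, ?q))) else 0) +
      of_real c * (of_real (ring_coupling N s (?a + 1) (l + 1)) * v l) * F2 $$ (?p, ?q))"
  proof (rule sum.cong, rule refl)
    fix l assume "l \<in> {..<N}"
    then have l: "l < N" by simp
    have J0: "?J $$ (i, 2 * l + 0) = of_real (if even i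
        then (if l = ?a then \<mu> - 2 * real s * c else 0) + c * ring_coupling N s (?a + 1) (l + 1)
        else if l = ?a then \<omega> else 0)"
      using l ij by (simp add: network_jacobian_index[OF s] network_linearization_def mod2_eq_if)
    have J1: "?J $$ (i, 2 * l + 1) = of_real (if odd i
        then (if l = ?a then \<mu> - 2 * real s * c else 0) + c * ring_coupling N s (?a + 1) (l + 1)
        else if l = ?a then - \<omega> else 0)"
      using l ij by (simp add: network_jacobian_index[OF s] network_linearization_def mod2_eq_if)
    show "?J $$ (i, 2 * l + 0) * ?U $$ (2 * l + 0, j) + ?J $$ (i, 2 * l + 1) * ?U $$ (2 * l + 1, j) =
      (if l = ?a then v l * (of_real (\<mu> - 2 * real s * c) * F2 $$ (?p, ?q) +
          (if even i then - of_real \<omega> * F2 $$ (1, ?q) else of_real \<omega> * F2 $$ (0, ?q))) else 0) +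
      of_real c * (of_real (ring_coupling N s (?a + 1) (l + 1)) * v l) * F2 $$ (?p, ?q)"
      unfolding J0 J1 U[OF l pos2] U[OF l one_less_two_nat]
      by (cases "even i"; cases "l = ?a") (simp_all add: mod2_eq_if algebra_simps)
  qed
  also have "\<dots> = v ?a * (of_real (\<mu> - 2 * real s * c) * F2 $$ (?p, ?q) +
          (if even i then - of_real \<omega> * F2 $$ (1, ?q) else of_real \<omega> * F2 $$ (0, ?q))) +
      of_real (2 * real s * c - coupling_shift N s c ?f) * v ?a * F2 $$ (?p, ?q)"
    unfolding sum.distrib sum_distrib_right[symmetric] sum_distrib_left[symmetric] shift
    using a by simp
  also have "\<dots> = v ?a * (\<eta> * F2 $$ (?p, ?q) +
          (if even i then - of_real \<omega> * F2 $$ (1, ?q) else of_real \<omega> * F2 $$ (0, ?q)))"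
    by (simp add: \<eta>_def algebra_simps)
  also have "\<dots> = v ?a * (F2 $$ (?p, 0) * scaled_rotation \<eta> (of_real (- \<omega>)) $$ (0, ?q) +
      F2 $$ (?p, 1) * scaled_rotation \<eta> (of_real (- \<omega>)) $$ (1, ?q))"
    by (cases "even i"; cases "even j") (simp_all add: mod2_eq_if F2_index algebra_simps)
  also have "\<dots> = (\<Sum>l<N. if l = ?f then v ?a * (F2 $$ (?p, 0) * scaled_rotation \<eta> (of_real (- \<omega>)) $$ (0, ?q) +
      F2 $$ (?p, 1) * scaled_rotation \<eta> (of_real (- \<omega>)) $$ (1, ?q)) else 0)"
    using f by simp
  also have "\<dots> = (\<Sum>l<N. ?U $$ (i, 2 * l + 0) * ?D $$ (2 * l + 0, j) +
      ?U $$ (i, 2 * l + 1) * ?D $$ (2 * l + 1, j))"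
  proof (rule sum.cong, rule refl)
    fix l assume "l \<in> {..<N}"
    then have l: "l < N" by simp
    have D: "?D $$ (2 * l + p, j) =
        (if l = ?f then scaled_rotation \<eta> (of_real (- \<omega>)) $$ (p, ?q) else 0)" if "p < 2" for p
      using that l ij by (simp only: fourier_diag_index[OF s] \<eta>_def) simp
    show "(if l = ?f then v ?a * (F2 $$ (?p, 0) * scaled_rotation \<eta> (of_real (- \<omega>)) $$ (0, ?q) +
      F2 $$ (?p, 1) * scaled_rotation \<eta> (of_real (- \<omega>)) $$ (1, ?q)) else 0) =
      ?U $$ (i, 2 * l + 0) * ?D $$ (2 * l + 0, j) + ?U $$ (i, 2 * l + 1) * ?D $$ (2 * l + 1, j)"
      unfolding D[of 0, simplified] D[of 1, simplified] D[of 0] D[of 1] U'[OF l, of 0, simplified]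
      using U'[OF l, of 0] U'[OF l, of 1] D[of 0] D[of 1]
      by (simp add: v_def algebra_simps del: scaled_rotation_index)
  qed
  also have "\<dots> = (\<Sum>k<2 * N. ?U $$ (i, k) * ?D $$ (k, j))"
    unfolding sum_upto_double by simp
  also have "\<dots> = (?U * ?D) $$ (i, j)"
    using ij by (intro times_mat_index_sum[symmetric] fourier_diag_carrier) auto
  finally show "(?J * ?U) $$ (i, j) = (?U * ?D) $$ (i, j)" .
next
  show "dim_row (?J * ?U) = dim_row (?U * ?D)" "dim_col (?J * ?U) = dim_col (?U * ?D)"
    using network_jacobian_carrier[of N s c \<omega> \<mu>] fourier_diag_carrier[of N s c \<omega> \<mu>]
      fourier_kron_carrier[of N] by auto
qed

lemma network_jacobian_unitarily_similar:
  assumes s: "2 * s < N"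
  shows "unitarily_similar (network_jacobian N s c \<omega> \<mu>) (fourier_diag N s c \<omega> \<mu>)"
  unfolding unitarily_similar_def
proof (intro exI similar_mat_witI)
  let ?J = "network_jacobian N s c \<omega> \<mu>" and ?U = "fourier_kron N" and ?D = "fourier_diag N s c \<omega> \<mu>"
  note carriers = network_jacobian_carrier[of N s c \<omega> \<mu>] fourier_diag_carrier[of N s c \<omega> \<mu>]
    fourier_kron_carrier[of N] mat_adjoint_carrier[OF fourier_kron_carrier[of N]]
  show UU: "?U * mat_adjoint ?U = 1\<^sub>m (2 * N)"
    using s by (intro fourier_kron_unitary) simp
  show "mat_adjoint ?U * ?U = 1\<^sub>m (2 * N)"
    by (rule mat_mult_left_right_inverse[OF carriers(3,4) UU])
  have "?U * ?D * mat_adjoint ?U = ?J * (?U * mat_adjoint ?U)"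
    unfolding jacobian_intertwined[OF s, symmetric]
    using carriers by (intro assoc_mult_mat) auto
  then show "?J = ?U * ?D * mat_adjoint ?U"
    using carriers by (simp add: UU)
qed (rule network_jacobian_carrier fourier_diag_carrier mat_adjoint_carrier fourier_kron_carrier)+

lemma char_poly_network_jacobian:
  assumes s: "2 * s < N"
  shows "char_poly (network_jacobian N s c \<omega> \<mu>) =
    (\<Prod>f\<leftarrow>[0..<N]. [:- Complex (\<mu> - coupling_shift N s c f) \<omega>, 1:] *
                      [:- Complex (\<mu> - coupling_shift N s c f) (- \<omega>), 1:])"
proof -
  have "char_poly (network_jacobian N s c \<omega> \<mu>) = char_poly (fourier_diag N s c \<omega> \<mu>)"
    using network_jacobian_unitarily_similar[OF s, of c \<omega> \<mu>]
    unfolding unitarily_similar_def by (intro char_poly_similar) (unfold similar_mat_def, blast)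
  also have "\<dots> = prod_list (map char_poly (map (fourier_block N s c \<omega> \<mu>) [1..<N + 1]))"
    by (rule char_poly_diag_block_mat) (auto simp: fourier_block_def)
  also have "[1..<N + 1] = map Suc [0..<N]"
    by (simp add: map_Suc_upt)
  finally show ?thesis
    by (simp add: fourier_block_eq[OF s] char_poly_scaled_rotation comp_def Complex_eq mult.commute)
qed

section \<open>Spectrum and multiplicities\<close>

lemma spectrum_network_jacobian:
  assumes s: "2 * s < N"
  shows "spectrum (network_jacobian N s c \<omega> \<mu>) =
    (\<Union>f<N. {Complex (\<mu> - coupling_shift N s c f) \<omega>, Complex (\<mu> - coupling_shift N s c f) (- \<omega>)})"
proof -
  let ?a = "\<lambda>f. Complex (\<mu> - coupling_shift N s c f) \<omega>"
  let ?b = "\<lambda>f. Complex (\<mu> - coupling_shift N s c f) (- \<omega>)"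
  have "poly (char_poly (network_jacobian N s c \<omega> \<mu>)) z =
      prod_list (map (\<lambda>f. (z - ?a f) * (z - ?b f)) [0..<N])" for z
    unfolding char_poly_network_jacobian[OF s] poly_prod_list map_map comp_def poly_mult by simp
  then show ?thesis
    unfolding spectrum_root_char_poly[OF network_jacobian_carrier]
    by (auto simp: prod_list_zero_iff image_iff)
qed

lemma imag_pair_Complex: "imag_pair \<omega> = {Complex 0 \<omega>, Complex 0 (- \<omega>)}"
  by (auto simp: imag_pair_def complex_eq_iff)

text \<open>
  As \<open>\<omega> \<noteq> 0\<close>, the two linear factors of a block are different, so a block contributes to the
  multiplicity of \<open>z\<close> at most once, and it does so exactly if its growth rate vanishes.
\<close>
lemma alg_mult_network_jacobian:
  assumes s: "2 * s < N" and \<omega>: "\<omega> \<noteq> 0" and z: "z \<in> imag_pair \<omega>"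
  shows "alg_mult (network_jacobian N s c \<omega> \<mu>) z = card {f. f < N \<and> coupling_shift N s c f = \<mu>}"
proof -
  let ?\<nu> = "coupling_shift N s c"
  let ?p = "\<lambda>f. [:- Complex (\<mu> - ?\<nu> f) \<omega>, 1:] * [:- Complex (\<mu> - ?\<nu> f) (- \<omega>), 1:]"
  have factor: "Polynomial.order z (?p f) = of_bool (?\<nu> f = \<mu>)" for f
  proof -
    have "?p f \<noteq> 0" by (simp only: mult_eq_0_iff) simp
    then have "Polynomial.order z (?p f) = Polynomial.order z [:- Complex (\<mu> - ?\<nu> f) \<omega>, 1:] +
        Polynomial.order z [:- Complex (\<mu> - ?\<nu> f) (- \<omega>), 1:]"
      by (rule order_mult)
    then show ?thesis
      using z \<omega> unfolding order_linear' imag_pair_Complex by auto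
  qed
  have "alg_mult (network_jacobian N s c \<omega> \<mu>) z = sum_list (map (Polynomial.order z) (map ?p [0..<N]))"
    unfolding alg_mult_def char_poly_network_jacobian[OF s]
    by (rule order_prod_list) (auto simp del: mult_pCons_left mult_pCons_right)
  also have "\<dots> = (\<Sum>f\<leftarrow>[0..<N]. of_bool (?\<nu> f = \<mu>))"
    unfolding map_map comp_def factor ..
  also have "\<dots> = (\<Sum>f\<in>{0..<N}. of_bool (?\<nu> f = \<mu>))"
    by (simp add: interv_sum_list_conv_sum_set_nat)
  also have "\<dots> = card ({0..<N} \<inter> {f. ?\<nu> f = \<mu>})" by simp
  also have "{0..<N} \<inter> {f. ?\<nu> f = \<mu>} = {f. f < N \<and> ?\<nu> f = \<mu>}" by auto
  finally show ?thesis .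
qed

lemma contributes_pair_iff:
  assumes s: "2 * s < N"
  shows "contributes_pair N s c \<omega> \<mu> j \<longleftrightarrow> coupling_shift N s c (j - 1) = \<mu>"
  by (auto simp: contributes_pair_def fourier_block_eq[OF s] spectrum_scaled_rotation imag_pair_def
      doubleton_eq_iff complex_eq_iff)

lemma jacobian_spectrum_imaginary_axis:
  assumes s: "2 * s < N" and "f < N" and "coupling_shift N s c f = \<mu>"
  shows "{z \<in> spectrum (network_jacobian N s c \<omega> \<mu>). Re z = 0} = imag_pair \<omega>"
  unfolding spectrum_network_jacobian[OF s] imag_pair_Complex using assms(2,3) by auto

section \<open>The synchronous mode\<close>

lemma jacobian_sync_field: "jacobian 2 (sync_field \<omega> \<mu>) (\<lambda>_. 0) = scaled_rotation (of_real \<mu>) (of_real \<omega>)"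
proof -
  let ?L = "\<lambda>i j :: nat. if i = j then \<mu> else if i = 0 then - \<omega> else \<omega>"
  have "sync_field \<omega> \<mu> ((\<lambda>_. 0)(j := t)) i = ?L i j * t - of_bool (i = j) * t ^ 3"
    if "i < 2" "j < 2" for i j t
    using that by (auto simp: less_2_nat sync_field_def power2_eq_square power3_eq_cube)
  then have "deriv (\<lambda>t. sync_field \<omega> \<mu> ((\<lambda>_. 0)(j := t)) i) 0 = ?L i j" if "i < 2" "j < 2" for i j
    using that deriv_linear_cubic by simp
  then show ?thesis
    by (intro eq_matI) (auto simp: jacobian_def)
qed

text \<open>
  On the circle of radius \<open>r\<close> the cubic term cancels the linear growth with rate \<open>r\<^sup>2\<close>, and what
  remains is a rotation with angular velocity \<open>\<omega>\<close>.
\<close>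
lemma periodic_orbit_sync_field:
  assumes "r \<noteq> 0" "\<omega> \<noteq> 0"
  shows "periodic_orbit 2 (sync_field \<omega> (r\<^sup>2)) (2 * pi / \<bar>\<omega>\<bar>)
    (\<lambda>t i. r * (if i = 0 then cos (\<omega> * t) else sin (\<omega> * t)))"
proof -
  let ?z = "\<lambda>t i :: nat. r * (if i = 0 then cos (\<omega> * t) else sin (\<omega> * t))"
  have radius: "(?z t 0)\<^sup>2 + (?z t 1)\<^sup>2 = r\<^sup>2" for t
    by (simp add: power_mult_distrib flip: distrib_left)
  have field: "sync_field \<omega> (r\<^sup>2) (?z t) i = (if i = 0 then - \<omega> * ?z t 1 else \<omega> * ?z t 0)" for t i
    unfolding sync_field_def radius by (simp add: algebra_simps)
  have period: "cos (\<omega> * (t + 2 * pi / \<bar>\<omega>\<bar>)) = cos (\<omega> * t)"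
    "sin (\<omega> * (t + 2 * pi / \<bar>\<omega>\<bar>)) = sin (\<omega> * t)" for t
  proof -
    have "\<omega> * (t + 2 * pi / \<bar>\<omega>\<bar>) = \<omega> * t + 2 * pi \<or> \<omega> * (t + 2 * pi / \<bar>\<omega>\<bar>) = \<omega> * t - 2 * pi"
      using assms by (cases "\<omega> > 0") (auto simp: field_simps)
    then show "cos (\<omega> * (t + 2 * pi / \<bar>\<omega>\<bar>)) = cos (\<omega> * t)"
      "sin (\<omega> * (t + 2 * pi / \<bar>\<omega>\<bar>)) = sin (\<omega> * t)"
      by (auto simp: cos_diff sin_diff)
  qed
  show ?thesis
    unfolding periodic_orbit_def
  proof (intro conjI allI impI)
    show "0 < 2 * pi / \<bar>\<omega>\<bar>" using assms by simp
    show "((\<lambda>\<tau>. ?z \<tau> i) has_real_derivative sync_field \<omega> (r\<^sup>2) (?z t) i) (at t)" for t i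
      unfolding field by (cases "i = 0") (auto intro!: derivative_eq_intros)
    show "?z (t + 2 * pi / \<bar>\<omega>\<bar>) i = ?z t i" for t i
      by (simp only: period)
    \<comment> \<open>Half a period leads to the opposite point.\<close>
    have "?z 0 0 \<noteq> ?z (pi / \<omega>) 0" using assms by simp
    then show "\<exists>t t'. \<exists>i<2. ?z t i \<noteq> ?z t' i" by (metis pos2)
  qed
qed

text \<open>
  The eigenvalue \<open>\<mu> + \<i> \<omega>\<close> crosses the axis with speed 1, and the circles of radius \<open>r\<close>, at
  parameter \<open>r\<^sup>2\<close> and with the constant period \<open>2 \<pi> / \<bar>\<omega>\<bar>\<close>, are the emanating periodic orbits.
\<close>
lemma hopf_bifurcation_sync_field:
  assumes "\<omega> \<noteq> 0"
  shows "hopf_bifurcation 2 (sync_field \<omega>) (\<lambda>_. 0) 0"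
proof -
  let ?ev = "\<lambda>\<mu>. of_real \<mu> + \<i> * of_real \<omega> :: complex"
  let ?z = "\<lambda>r t i :: nat. r * (if i = 0 then cos (\<omega> * t) else sin (\<omega> * t))"
  have simple: "alg_mult (jacobian 2 (sync_field \<omega> 0) (\<lambda>_. 0)) (?ev 0) = 1"
  proof -
    have "Polynomial.order (?ev 0) ([:- ?ev 0, 1:] * [:- (of_real 0 - \<i> * of_real \<omega>), 1:]) =
        Polynomial.order (?ev 0) [:- ?ev 0, 1:] +
        Polynomial.order (?ev 0) [:- (of_real 0 - \<i> * of_real \<omega>), 1:]"
      by (rule order_mult) (simp only: mult_eq_0_iff, simp)
    then show ?thesis
      unfolding alg_mult_def jacobian_sync_field char_poly_scaled_rotation order_linear'
      using assms by (simp add: complex_eq_iff)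
  qed
  have small: "\<forall>\<^sub>F r in at_right 0. \<forall>t. \<forall>i<2. \<bar>?z r t i - 0\<bar> < \<delta>" if "\<delta> > 0" for \<delta> :: real
  proof -
    have "\<forall>\<^sub>F r in at_right 0. r \<in> {0<..<\<delta>}"
      using that by (rule eventually_at_right_real)
    then show ?thesis
    proof (rule eventually_mono)
      fix r :: real assume r: "r \<in> {0<..<\<delta>}"
      show "\<forall>t. \<forall>i<2. \<bar>?z r t i - 0\<bar> < \<delta>"
      proof (intro allI impI)
        fix t and i :: nat
        have "\<bar>if i = 0 then cos (\<omega> * t) else sin (\<omega> * t)\<bar> \<le> 1" by simp
        then have "\<bar>?z r t i\<bar> \<le> r * 1"
          using r unfolding abs_mult by (intro mult_mono) auto
        then show "\<bar>?z r t i - 0\<bar> < \<delta>" using r by simp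
      qed
    qed
  qed
  have orbits: "\<forall>\<^sub>F r in at_right 0. periodic_orbit 2 (sync_field \<omega> (r\<^sup>2)) (2 * pi / \<bar>\<omega>\<bar>) (?z r)"
    using periodic_orbit_sync_field[OF _ assms]
    by (auto simp: eventually_at_filter)
  have speed: "((\<lambda>\<mu>. Re (?ev \<mu>)) has_real_derivative 1) (at 0)"
    by (auto intro!: derivative_eq_intros)
  have m: "((\<lambda>r :: real. r\<^sup>2) \<longlongrightarrow> 0) (at_right 0)"
    by (auto intro!: tendsto_eq_intros)
  have family: "\<exists>(m :: real \<Rightarrow> real) (T :: real \<Rightarrow> real) (z :: real \<Rightarrow> real \<Rightarrow> nat \<Rightarrow> real).
      (\<forall>\<^sub>F r in at_right 0. periodic_orbit 2 (sync_field \<omega> (m r)) (T r) (z r)) \<and>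
      (m \<longlongrightarrow> 0) (at_right 0) \<and>
      (T \<longlongrightarrow> 2 * pi / \<bar>Im (?ev 0)\<bar>) (at_right 0) \<and>
      (\<forall>\<delta>>0. \<forall>\<^sub>F r in at_right 0. \<forall>t. \<forall>i<2. \<bar>z r t i - 0\<bar> < \<delta>)"
  proof (rule exI[of _ "\<lambda>r. r\<^sup>2"], rule exI[of _ "\<lambda>_. 2 * pi / \<bar>\<omega>\<bar>"], rule exI[of _ ?z], intro conjI)
    show "\<forall>\<delta>>0. \<forall>\<^sub>F r in at_right 0. \<forall>t. \<forall>i<2. \<bar>?z r t i - 0\<bar> < \<delta>" using small by blast
  qed (use orbits m in simp_all)
  show ?thesis
    unfolding hopf_bifurcation_def
  proof (intro conjI exI[of _ ?ev] exI[of _ "1 :: real"])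
    show "\<forall>\<^sub>F \<mu> in nhds 0. \<forall>i<2. sync_field \<omega> \<mu> (\<lambda>_. 0) i = 0"
      by (simp add: sync_field_def)
    show "\<forall>\<^sub>F \<mu> in nhds 0. ?ev \<mu> \<in> spectrum (jacobian 2 (sync_field \<omega> \<mu>) (\<lambda>_. 0))"
      by (simp add: jacobian_sync_field spectrum_scaled_rotation)
    show "isCont ?ev 0" by (intro continuous_intros)
    show "{\<nu> \<in> spectrum (jacobian 2 (sync_field \<omega> 0) (\<lambda>_. 0)). Re \<nu> = 0} = {?ev 0, cnj (?ev 0)}"
      by (auto simp: jacobian_sync_field spectrum_scaled_rotation)
  qed (use assms simple speed family in simp_all)
qed

lemma network_field_synchronous:
  assumes "i < 2 * N"
  shows "network_field N s c \<omega> \<mu> (\<lambda>m. u (m mod 2)) i = sync_field \<omega> \<mu> u (i mod 2)"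
  by (cases "even i")
     (simp_all add: network_field_def x_dot_def y_dot_def x_of_def y_of_def sync_field_def mod2_eq_if)

section \<open>Critical parameter values\<close>

theorem theorem4p2:
  fixes N s :: nat and c \<omega> :: real
  assumes "c > 0" and "\<omega> \<noteq> 0" and "non_all_to_all N s"
  shows
    "(\<forall>\<mu>. unitarily_similar (network_jacobian N s c \<omega> \<mu>)
            (diag_block_mat (map (fourier_block N s c \<omega> \<mu>) [1..<N + 1]))) \<and>
     hopf_bifurcation 2 (sync_field \<omega>) (\<lambda>_. 0) 0 \<and>
     (\<forall>\<mu> u. \<forall>i<2 * N.
        network_field N s c \<omega> \<mu> (\<lambda>m. u (m mod 2)) i = sync_field \<omega> \<mu> u (i mod 2)) \<and>
     (\<forall>\<mu>. spectrum (fourier_block N s c \<omega> \<mu> 1) = spectrum (jacobian 2 (sync_field \<omega> \<mu>) (\<lambda>_. 0))) \<and>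
     contributes_pair N s c \<omega> 0 1 \<and>
     (\<forall>j\<in>{2..N}.
        critical_mu N s c j \<noteq> 0 \<and>
        critical_value N s c \<omega> (critical_mu N s c j) \<and>
        imag_pair \<omega> \<subseteq> spectrum (network_jacobian N s c \<omega> (critical_mu N s c j)) \<and>
        contributes_pair N s c \<omega> (critical_mu N s c j) j \<and>
        N + 2 - j \<in> {2..N} \<and>
        critical_mu N s c j = critical_mu N s c (N + 2 - j)) \<and>
     (even N \<longrightarrow>
        (\<forall>j\<in>{2..N}. j \<noteq> 1 + N div 2 \<longrightarrow>
           j \<noteq> N + 2 - j \<and>
           contributes_pair N s c \<omega> (critical_mu N s c j) j \<and>
           contributes_pair N s c \<omega> (critical_mu N s c j) (N + 2 - j) \<and>
           pairs_contributed N s c \<omega> (critical_mu N s c j) {j, N + 2 - j} = 2)) \<and>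
     (even N \<longrightarrow>
        (\<forall>j. j = 1 + N div 2 \<longrightarrow>
           j \<in> {2..N} \<and>
           j = N + 2 - j \<and>
           contributes_pair N s c \<omega> (critical_mu N s c j) j \<and>
           pairs_contributed N s c \<omega> (critical_mu N s c j) {j, N + 2 - j} = 1 \<and>
           ((\<forall>k\<in>{2..N}. k \<noteq> j \<longrightarrow> critical_mu N s c j \<noteq> critical_mu N s c k) \<longrightarrow>
              pairs_contributed N s c \<omega> (critical_mu N s c j) {1..N} = 1 \<and>
              {z \<in> spectrum (network_jacobian N s c \<omega> (critical_mu N s c j)). Re z = 0} = imag_pair \<omega> \<and>
              (\<forall>z\<in>imag_pair \<omega>. alg_mult (network_jacobian N s c \<omega> (critical_mu N s c j)) z = 1)))) \<and>
     (odd N \<longrightarrow>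
        (\<forall>j\<in>{2..N}.
           j \<noteq> N + 2 - j \<and>
           contributes_pair N s c \<omega> (critical_mu N s c j) j \<and>
           contributes_pair N s c \<omega> (critical_mu N s c j) (N + 2 - j) \<and>
           pairs_contributed N s c \<omega> (critical_mu N s c j) {j, N + 2 - j} = 2))"
proof -
  note s1 = non_all_to_all_bounds(1)[OF assms(3)] and s = non_all_to_all_bounds(2)[OF assms(3)]
  let ?\<nu> = "coupling_shift N s c"
  have crit: "critical_mu N s c j = ?\<nu> (j - 1)" if "j \<in> {2..N}" for j
    using that by (rule critical_mu_eq_coupling_shift)
  have pos: "0 < ?\<nu> (j - 1)" if "j \<in> {2..N}" for j
    using that by (intro coupling_shift_pos assms(1) s1) auto
  have reflect: "?\<nu> (N + 2 - j - 1) = ?\<nu> (j - 1)" if "j \<in> {2..N}" for j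
  proof -
    have "N + 2 - j - 1 = N - (j - 1)" using that by auto
    then show ?thesis using that by (simp only:) (rule coupling_shift_reflect; auto)
  qed
  have axis: "{z \<in> spectrum (network_jacobian N s c \<omega> (?\<nu> (j - 1))). Re z = 0} = imag_pair \<omega>"
    if "j \<in> {2..N}" for j
    using that by (intro jacobian_spectrum_imaginary_axis[OF s, of "j - 1"]) auto
  note contributes = contributes_pair_iff[OF s]
  have pairs: "pairs_contributed N s c \<omega> \<mu> S = card {j \<in> S. ?\<nu> (j - 1) = \<mu>}" for \<mu> S
    by (simp only: pairs_contributed_def contributes)
  have each: "critical_mu N s c j \<noteq> 0 \<and>
        critical_value N s c \<omega> (critical_mu N s c j) \<and>
        imag_pair \<omega> \<subseteq> spectrum (network_jacobian N s c \<omega> (critical_mu N s c j)) \<and>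
        contributes_pair N s c \<omega> (critical_mu N s c j) j \<and>
        N + 2 - j \<in> {2..N} \<and>
        critical_mu N s c j = critical_mu N s c (N + 2 - j)" if j: "j \<in> {2..N}" for j
  proof -
    have j': "N + 2 - j \<in> {2..N}" using j by auto
    have "\<i> * of_real \<omega> \<in> imag_pair \<omega>" by (simp add: imag_pair_def)
    then have "critical_value N s c \<omega> (?\<nu> (j - 1))"
      unfolding critical_value_def axis[OF j, symmetric] by blast
    moreover have "critical_mu N s c (N + 2 - j) = ?\<nu> (j - 1)"
      by (simp only: crit[OF j'] reflect[OF j])
    ultimately show ?thesis
      using j' pos[OF j] axis[OF j] unfolding crit[OF j] contributes by auto
  qed
  have two: "contributes_pair N s c \<omega> (critical_mu N s c j) j \<and>
           contributes_pair N s c \<omega> (critical_mu N s c j) (N + 2 - j) \<and>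
           pairs_contributed N s c \<omega> (critical_mu N s c j) {j, N + 2 - j} = 2"
    if j: "j \<in> {2..N}" and ne: "j \<noteq> N + 2 - j" for j
  proof -
    have "{k \<in> {j, N + 2 - j}. ?\<nu> (k - 1) = ?\<nu> (j - 1)} = {j, N + 2 - j}"
      using reflect[OF j] by blast
    then show ?thesis
      using ne by (simp only: crit[OF j] contributes pairs reflect[OF j]) simp
  qed
  have middle: "j \<in> {2..N} \<and>
           j = N + 2 - j \<and>
           contributes_pair N s c \<omega> (critical_mu N s c j) j \<and>
           pairs_contributed N s c \<omega> (critical_mu N s c j) {j, N + 2 - j} = 1 \<and>
           ((\<forall>k\<in>{2..N}. k \<noteq> j \<longrightarrow> critical_mu N s c j \<noteq> critical_mu N s c k) \<longrightarrow>
              pairs_contributed N s c \<omega> (critical_mu N s c j) {1..N} = 1 \<and>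
              {z \<in> spectrum (network_jacobian N s c \<omega> (critical_mu N s c j)). Re z = 0} = imag_pair \<omega> \<and>
              (\<forall>z\<in>imag_pair \<omega>. alg_mult (network_jacobian N s c \<omega> (critical_mu N s c j)) z = 1))"
    if "even N" "j = 1 + N div 2" for j
  proof (intro conjI impI)
    show j: "j \<in> {2..N}" using that s s1 by auto
    show mid: "j = N + 2 - j" using that by (elim evenE) simp
    show "contributes_pair N s c \<omega> (critical_mu N s c j) j"
      by (simp add: crit[OF j] contributes)
    have "{k \<in> {j, N + 2 - j}. ?\<nu> (k - 1) = ?\<nu> (j - 1)} = {j}" using mid by auto
    then show "pairs_contributed N s c \<omega> (critical_mu N s c j) {j, N + 2 - j} = 1"
      by (simp only: crit[OF j] pairs) simp
    show "{z \<in> spectrum (network_jacobian N s c \<omega> (critical_mu N s c j)). Re z = 0} = imag_pair \<omega>"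
      by (simp only: crit[OF j] axis[OF j])
    assume distinct: "\<forall>k\<in>{2..N}. k \<noteq> j \<longrightarrow> critical_mu N s c j \<noteq> critical_mu N s c k"
    \<comment> \<open>The synchronous block cannot interfere: its value is 0, that of \<open>j\<close> is positive.\<close>
    have unique: "k = j" if "k \<in> {1..N}" "?\<nu> (k - 1) = ?\<nu> (j - 1)" for k
    proof (cases "k = 1")
      case True
      then show ?thesis using that pos[OF j] by simp
    next
      case False
      then have "k \<in> {2..N}" using that by auto
      then show ?thesis using that distinct crit j by metis
    qed
    have "{k \<in> {1..N}. ?\<nu> (k - 1) = ?\<nu> (j - 1)} = {j}" using unique j by auto
    then show "pairs_contributed N s c \<omega> (critical_mu N s c j) {1..N} = 1"
      by (simp only: crit[OF j] pairs) simp
    have "f = j - 1" if "f < N" "?\<nu> f = ?\<nu> (j - 1)" for f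
      using unique[of "f + 1"] that by simp
    then have "{f. f < N \<and> ?\<nu> f = ?\<nu> (j - 1)} = {j - 1}" using j by auto
    then show "\<forall>z\<in>imag_pair \<omega>. alg_mult (network_jacobian N s c \<omega> (critical_mu N s c j)) z = 1"
      by (simp add: crit[OF j] alg_mult_network_jacobian[OF s assms(2)])
  qed
  have sync: "spectrum (fourier_block N s c \<omega> \<mu> 1) = spectrum (jacobian 2 (sync_field \<omega> \<mu>) (\<lambda>_. 0))" for \<mu>
    by (auto simp: fourier_block_eq[OF s] jacobian_sync_field spectrum_scaled_rotation)
  have distinct_even: "j \<noteq> N + 2 - j" if "even N" "j \<noteq> 1 + N div 2" for j
    using that by presburger
  have distinct_odd: "j \<noteq> N + 2 - j" if "odd N" for j
    using that by presburger
  show ?thesis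
  proof (intro conjI, goal_cases)
    case 1
    show ?case using network_jacobian_unitarily_similar[OF s] by (rule allI)
  next
    case 2
    show ?case using assms(2) by (rule hopf_bifurcation_sync_field)
  next
    case 3
    show ?case by (intro allI impI network_field_synchronous)
  next
    case 4
    show ?case using sync by (rule allI)
  next
    case 5
    show ?case by (simp add: contributes)
  next
    case 6
    show ?case using each by (rule ballI)
  next
    case 7
    show ?case using two distinct_even by (intro impI ballI conjI) blast+
  next
    case 8
    show ?case using middle by (intro impI allI)
  next
    case 9
    show ?case using two distinct_odd by (intro impI ballI conjI) blast+
  qed
qed

end
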